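(* For every partial Boolean function $g\subseteq\{0,1\}^m\times\{0,1\}$, \[\mathrm{RS}(g)=\min_{\mathcal T}\max_{x,y:\ g(x)\ne g(y)}\mathbb E_{T\sim\mathcal T}[\mathrm{sep}_T(x,y)]=\max_p\min_T\mathbb E_{(x,y)\sim p}[\mathrm{sep}_T(x,y)],\] where in the first expression the minimum is over zero-error randomized algorithms $\mathcal T$ for $g$ (probability distributions over deterministic decision trees computing $g$) and the maximum is over valid inputs $x,y$ with $g(x)\ne g(y)$, and in the second expression the maximum is over probability distributions $p$ over pairs $(x,y)$ with $g(x)=0$, $g(y)=1$, and the minimum is over deterministic decision trees $T$ computing $g$.
   Context: $g^{-1}(b)$ is the set of $x$ with $(x,b)\in g$ and $(x,1-b)\notin g$; valid inputs are $g^{-1}(0)\cup g^{-1}(1)$, on which $g(x)$ denotes the unique such $b$. A deterministic decision tree $T$ queries index $q(v)$ at internal node $v$; it computes $g$ if it outputs $b$ on every $x\in g^{-1}(b)$. For $x,y$ with $g(x)\ne g(y)$, $\mathrm{sep}_T(x,y)$ is the depth (number of vertices on the root-to-node path, root having depth $1$) of the node $v$ reached by both $x$ and $y$ with $x_{q(v)}\ne y_{q(v)}$. Sabotage complexity: let $P^*\subseteq\{0,1,*\}^m$ be the set of strings $z$ for which there exist $x\in g^{-1}(0)$, $y\in g^{-1}(1)$ both agreeing with $z$ on all non-$*$ coordinates; $P^\dagger\subseteq\{0,1,\dagger\}^m$ is defined analogously with $\dagger$. Define $g_{\mathrm{sab}}:P^*\cup P^\dagger\to\{*,\dagger\}$ by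 $g_{\mathrm{sab}}(z)=*$ on $P^*$ and $\dagger$ on $P^\dagger$. $\mathrm{RS}(g)=\mathrm{R}_0(g_{\mathrm{sab}})$, the zero-error randomized query complexity: the minimum over randomized query algorithms that are always correct on the domain of the maximum over inputs of the expected number of queries. *)

theory Defs
  imports "HOL-Probability.Probability"
begin

text \<open>
  Strings of length \<open>m\<close> over an alphabet \<open>'a\<close> are lists of length \<open>m\<close>, with coordinates
  \<open>0, \<dots>, m - 1\<close>.  A node \<open>Query i k\<close> queries coordinate \<open>i\<close> and continues with \<open>k a\<close> on
  answer \<open>a\<close>.
\<close>

datatype ('a, 'o) dtree = Answer 'o | Query nat "'a \<Rightarrow> ('a, 'o) dtree"

primrec wf_dtree :: "nat \<Rightarrow> ('a, 'o) dtree \<Rightarrow> bool" where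
  "wf_dtree m (Answer c) \<longleftrightarrow> True"
| "wf_dtree m (Query i k) \<longleftrightarrow> i < m \<and> (\<forall>a. wf_dtree m (k a))"

primrec tree_output :: "('a, 'o) dtree \<Rightarrow> 'a list \<Rightarrow> 'o" where
  "tree_output (Answer c) x = c"
| "tree_output (Query i k) x = tree_output (k (x ! i)) x"

primrec queries :: "('a, 'o) dtree \<Rightarrow> 'a list \<Rightarrow> nat" where
  "queries (Answer c) x = 0"
| "queries (Query i k) x = Suc (queries (k (x ! i)) x)"

text \<open>
  Depth (the root having depth 1) of the node reached by both \<open>x\<close> and \<open>y\<close> whose query
  distinguishes them.  The \<open>Answer\<close> case is a dummy: it is never reached from the root of a
  tree that gives different outputs on \<open>x\<close> and \<open>y\<close>.
\<close>

primrec sep :: "('a, 'o) dtree \<Rightarrow> 'a list \<Rightarrow> 'a list \<Rightarrow> nat" where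
  "sep (Answer c) x y = 0"
| "sep (Query i k) x y = (if x ! i \<noteq> y ! i then 1 else Suc (sep (k (x ! i)) x y))"

definition computes :: "('a, 'o) dtree \<Rightarrow> ('a list \<rightharpoonup> 'o) \<Rightarrow> bool" where
  "computes T f \<longleftrightarrow> (\<forall>x c. f x = Some c \<longrightarrow> tree_output T x = c)"

definition det_algs :: "nat \<Rightarrow> ('a list \<rightharpoonup> 'o) \<Rightarrow> ('a, 'o) dtree set" where
  "det_algs m f = {T. wf_dtree m T \<and> computes T f}"

text \<open>
  For the finite alphabets used below there are only countably many trees, so \<open>pmf\<close> covers
  all probability distributions over them.
\<close>

definition zero_error_algs :: "nat \<Rightarrow> ('a list \<rightharpoonup> 'o) \<Rightarrow> ('a, 'o) dtree pmf set" where
  "zero_error_algs m f = {\<T>. set_pmf \<T> \<subseteq> det_algs m f}"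

text \<open>
  Expectations and optima are taken in \<open>ennreal\<close>: a distribution with infinite expected cost
  has value \<open>\<infinity>\<close>, and a maximum over the empty set is \<open>0\<close>.
\<close>

definition worst_queries :: "('a list \<rightharpoonup> 'o) \<Rightarrow> ('a, 'o) dtree pmf \<Rightarrow> ennreal" where
  "worst_queries f \<T> = (SUP z \<in> dom f. \<integral>\<^sup>+ T. of_nat (queries T z) \<partial>measure_pmf \<T>)"

definition R0 :: "nat \<Rightarrow> ('a list \<rightharpoonup> 'o) \<Rightarrow> ennreal" where
  "R0 m f = (INF \<T> \<in> zero_error_algs m f. worst_queries f \<T>)"

definition ginv :: "(bool list \<times> bool) set \<Rightarrow> bool \<Rightarrow> bool list set" where
  "ginv g b = {x. (x, b) \<in> g \<and> (x, \<not> b) \<notin> g}"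

definition pfun :: "(bool list \<times> bool) set \<Rightarrow> bool list \<rightharpoonup> bool" where
  "pfun g x = (if x \<in> ginv g False then Some False
               else if x \<in> ginv g True then Some True else None)"

datatype mark = Star | Dagger

datatype symbol = Bit bool | Mark mark

definition sab_inputs :: "nat \<Rightarrow> (bool list \<times> bool) set \<Rightarrow> mark \<Rightarrow> symbol list set" where
  "sab_inputs m g s = {z. length z = m \<and> set z \<subseteq> range Bit \<union> {Mark s} \<and>
     (\<exists>x \<in> ginv g False. \<exists>y \<in> ginv g True.
        \<forall>i < m. z ! i \<noteq> Mark s \<longrightarrow> z ! i = Bit (x ! i) \<and> z ! i = Bit (y ! i))}"

text \<open>
  When all strings in \<open>g\<close> have length \<open>m\<close>, the sets \<open>sab_inputs m g Star\<close> and
  \<open>sab_inputs m g Dagger\<close> are disjoint: a string in both would have no mark and hence be in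
  \<open>ginv g False \<inter> ginv g True\<close>.
\<close>

definition g_sab :: "nat \<Rightarrow> (bool list \<times> bool) set \<Rightarrow> symbol list \<rightharpoonup> mark" where
  "g_sab m g z = (if z \<in> sab_inputs m g Star then Some Star
                  else if z \<in> sab_inputs m g Dagger then Some Dagger else None)"

definition RS :: "nat \<Rightarrow> (bool list \<times> bool) set \<Rightarrow> ennreal" where
  "RS m g = R0 m (g_sab m g)"

definition sep_pairs :: "(bool list \<times> bool) set \<Rightarrow> (bool list \<times> bool list) set" where
  "sep_pairs g = {(x, y). x \<in> dom (pfun g) \<and> y \<in> dom (pfun g) \<and> pfun g x \<noteq> pfun g y}"

definition exp_sep_alg :: "(bool, bool) dtree pmf \<Rightarrow> bool list \<times> bool list \<Rightarrow> ennreal" where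
  "exp_sep_alg \<T> = (\<lambda>(x, y). \<integral>\<^sup>+ T. of_nat (sep T x y) \<partial>measure_pmf \<T>)"

definition worst_sep :: "(bool list \<times> bool) set \<Rightarrow> (bool, bool) dtree pmf \<Rightarrow> ennreal" where
  "worst_sep g \<T> = (SUP xy \<in> sep_pairs g. exp_sep_alg \<T> xy)"

definition pair_dists :: "(bool list \<times> bool) set \<Rightarrow> (bool list \<times> bool list) pmf set" where
  "pair_dists g = {p. set_pmf p \<subseteq> ginv g False \<times> ginv g True}"

definition exp_sep_dist ::
    "(bool list \<times> bool list) pmf \<Rightarrow> (bool, bool) dtree \<Rightarrow> ennreal" where
  "exp_sep_dist p T = (\<integral>\<^sup>+ (x, y). of_nat (sep T x y) \<partial>measure_pmf p)"

definition best_sep ::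
    "nat \<Rightarrow> (bool list \<times> bool) set \<Rightarrow> (bool list \<times> bool list) pmf \<Rightarrow> ennreal" where
  "best_sep m g p = (INF T \<in> det_algs m (pfun g). exp_sep_dist p T)"

definition has_min :: "('s \<Rightarrow> ennreal) \<Rightarrow> 's set \<Rightarrow> bool" where
  "has_min F S \<longleftrightarrow> (\<exists>s \<in> S. \<forall>t \<in> S. F s \<le> F t)"

definition has_max :: "('s \<Rightarrow> ennreal) \<Rightarrow> 's set \<Rightarrow> bool" where
  "has_max F S \<longleftrightarrow> (\<exists>s \<in> S. \<forall>t \<in> S. F t \<le> F s)"

end

theory Submission
  imports Defs
begin

text \<open>
  A tree for \<open>g\<close> that separates \<open>x\<close> from \<open>y\<close> finds a mark, on any sabotaged input built from
  \<open>x\<close> and \<open>y\<close>, no later than at the separating node.  Conversely, a tree for the sabotage problem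
  must query a mark on the input that hides exactly the differences of \<open>x\<close> and \<open>y\<close>, since
  otherwise it could not tell \<open>Star\<close> from \<open>Dagger\<close>; run on Boolean inputs, and followed by any
  tree for \<open>g\<close>, it separates \<open>x\<close> from \<open>y\<close> within that many queries.  This is the first
  equality.

  The second one is von Neumann's minimax theorem.  Repeated queries can be removed from a tree
  without increasing any cost, so only finitely many cost vectors matter.  For the finite game,
  minimise over mixed strategies \<open>q\<close> of the columns the squared distance from \<open>A q\<close> to the
  orthant \<open>{u. \<forall>i. u i \<le> v}\<close>: either the minimum is \<open>0\<close>, or the normalised residual is a mixed
  strategy of the rows that guarantees more than \<open>v\<close>.
\<close>

section \<open>The minimax theorem for finite games\<close>

text \<open>Mixed strategies on \<open>J\<close>, encoded as total functions that vanish off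
  \<open>J\<close>, so that they form a compact set in the product topology on all
  functions.\<close>

definition weights :: "'a set \<Rightarrow> ('a \<Rightarrow> real) set" where
  "weights J = {w. (\<forall>j. 0 \<le> w j) \<and> (\<forall>j. j \<notin> J \<longrightarrow> w j = 0) \<and> sum w J = 1}"

text \<open>Tychonoff: the simplex is a closed subset of a product of unit intervals and, off
  \<open>J\<close>, of singletons.\<close>

lemma compact_weights:
  fixes J :: "'a set"
  assumes "finite J"
  shows "compact (weights J)"
proof -
  define S :: "'a \<Rightarrow> real set" where "S = (\<lambda>j. if j \<in> J then {0..1} else {0})"
  have "compactin (product_topology (\<lambda>_. euclidean) UNIV) (PiE UNIV S)"
    unfolding compactin_PiE by (auto simp: S_def)
  then have "compact (PiE UNIV S)"
    by (simp add: euclidean_product_topology)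
  moreover have "closed {w :: 'a \<Rightarrow> real. sum w J = 1}"
    by (intro closed_Collect_eq continuous_intros)
       (auto intro: continuous_on_subset[OF continuous_on_product_coordinates])
  moreover have "weights J = PiE UNIV S \<inter> {w. sum w J = 1}"
  proof -
    have "w j \<le> 1" if "w \<in> weights J" "j \<in> J" for w j
      using member_le_sum[of j J w] that assms by (auto simp: weights_def)
    then show ?thesis
      by (fastforce simp: weights_def S_def PiE_def Pi_def split: if_splits)
  qed
  ultimately show ?thesis
    by (simp add: compact_Int_closed)
qed

lemma indicator_in_weights: "finite J \<Longrightarrow> j \<in> J \<Longrightarrow> indicator {j} \<in> weights J"
  by (auto simp: weights_def indicator_def)

lemma weights_nonempty: "finite J \<Longrightarrow> J \<noteq> {} \<Longrightarrow> weights J \<noteq> {}"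
  using indicator_in_weights[of J] by fast

lemma convex_comb_in_weights:
  assumes "u \<in> weights J" "w \<in> weights J" "0 \<le> t" "t \<le> 1"
  shows "(\<lambda>j. (1 - t) * u j + t * w j) \<in> weights J"
  using assms by (auto simp: weights_def sum.distrib simp flip: sum_distrib_left)

lemma continuous_on_Min:
  fixes f :: "'b \<Rightarrow> 'a::topological_space \<Rightarrow> real"
  assumes "finite J" "J \<noteq> {}" "\<And>j. j \<in> J \<Longrightarrow> continuous_on K (f j)"
  shows "continuous_on K (\<lambda>x. Min ((\<lambda>j. f j x) ` J))"
  using assms
proof (induction rule: finite_ne_induct)
  case (insert j J)
  then have "continuous_on K (\<lambda>x. min (f j x) (Min ((\<lambda>j. f j x) ` J)))"
    by (intro continuous_intros) auto
  then show ?case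
    using insert.hyps by simp
qed simp

text \<open>Divide by \<open>t\<close> and let \<open>t\<close> tend to 0 from the right.\<close>

lemma nonneg_if_quadratic_nonneg:
  fixes a b :: real
  assumes "\<And>t. 0 < t \<Longrightarrow> t \<le> 1 \<Longrightarrow> 0 \<le> t * a + t\<^sup>2 * b"
  shows "0 \<le> a"
proof (rule tendsto_lowerbound)
  show "((\<lambda>t. a + t * b) \<longlongrightarrow> a) (at_right 0)"
    by (auto intro!: tendsto_eq_intros)
  have "0 \<le> a + t * b" if "0 < t" "t < 1" for t
  proof -
    have "0 \<le> t * (a + t * b)"
      using assms[of t] that by (simp add: algebra_simps power2_eq_square)
    then show ?thesis
      using that by (simp add: zero_le_mult_iff)
  qed
  then show "\<forall>\<^sub>F t in at_right 0. 0 \<le> a + t * b"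
    by (auto simp: eventually_at_right[of 0 1] intro!: exI[of _ 1])
qed simp

lemma minimax_alternative:
  fixes A :: "'i \<Rightarrow> 'j \<Rightarrow> real"
  assumes "finite I" "finite J" "J \<noteq> {}"
  shows "(\<exists>q \<in> weights J. \<forall>i\<in>I. (\<Sum>j\<in>J. q j * A i j) \<le> v) \<or>
         (\<exists>p \<in> weights I. \<forall>j\<in>J. v < (\<Sum>i\<in>I. p i * A i j))"
proof -
  define L where "L q i = (\<Sum>j\<in>J. q j * A i j)" for q i
  define \<Phi> where "\<Phi> q = (\<Sum>i\<in>I. (max 0 (L q i - v))\<^sup>2)" for q
  have "continuous_on (weights J) \<Phi>"
    unfolding \<Phi>_def L_def
    by (intro continuous_intros continuous_on_subset[OF continuous_on_product_coordinates]) auto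
  moreover have "weights J \<noteq> {}"
    using assms by (intro weights_nonempty)
  ultimately obtain q where q: "q \<in> weights J" and min: "\<And>q'. q' \<in> weights J \<Longrightarrow> \<Phi> q \<le> \<Phi> q'"
    using continuous_attains_inf[OF compact_weights[OF \<open>finite J\<close>], of \<Phi>] by auto
  define r where "r i = max 0 (L q i - v)" for i
  show ?thesis
  proof (cases "\<forall>i\<in>I. r i = 0")
    case True
    then have "\<forall>i\<in>I. L q i \<le> v"
      by (auto simp: r_def max_def split: if_splits)
    with q show ?thesis
      by (auto simp: L_def)
  next
    case False
    have r_nonneg: "0 \<le> r i" for i
      by (simp add: r_def)
    define R where "R = sum r I"
    have "0 < R"
      using False r_nonneg \<open>finite I\<close> unfolding R_def
      by (metis sum_nonneg sum_nonneg_eq_0_iff less_eq_real_def)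
    have sq: "0 < (\<Sum>i\<in>I. (r i)\<^sup>2)"
      using False r_nonneg \<open>finite I\<close>
      by (metis sum_pos2 zero_less_power2 zero_le_power2)
    have "v < (\<Sum>i\<in>I. r i / R * A i j)" if "j \<in> J" for j
    proof -
      define b where "b i = A i j - L q i" for i
      \<comment> \<open>First-order condition at the minimiser in the direction of the vertex \<open>j\<close>.\<close>
      have "0 \<le> 2 * (\<Sum>i\<in>I. r i * b i)"
      proof (rule nonneg_if_quadratic_nonneg[where b = "\<Sum>i\<in>I. (b i)\<^sup>2"])
        fix t :: real
        assume t: "0 < t" "t \<le> 1"
        define u where "u = (\<lambda>k. (1 - t) * q k + t * indicator {j} k)"
        have "u \<in> weights J"
          unfolding u_def using t q that assms
          by (intro convex_comb_in_weights indicator_in_weights) auto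
        have "L u i = L q i + t * b i" for i
        proof -
          have "L u i = (1 - t) * L q i + t * (\<Sum>k\<in>J. indicator {j} k * A i k)"
            by (simp add: L_def u_def algebra_simps sum.distrib sum_subtractf sum_distrib_left)
          also have "(\<Sum>k\<in>J. indicator {j} k * A i k) = A i j"
            using that assms by (simp add: indicator_def of_bool_def if_distrib[of "\<lambda>x. x * _"] cong: if_cong)
          finally show ?thesis
            by (simp add: b_def algebra_simps)
        qed
        \<comment> \<open>Replacing \<open>L q i - v\<close> by the possibly larger
          \<open>r i\<close> majorises \<open>\<Phi> u\<close> by a quadratic in \<open>t\<close>
          whose value at 0 is \<open>\<Phi> q\<close>.\<close>
        then have "(max 0 (L u i - v))\<^sup>2 \<le> (r i + t * b i)\<^sup>2" for i
          unfolding abs_le_square_iff[symmetric] r_def by auto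
        then have "\<Phi> u \<le> (\<Sum>i\<in>I. (r i + t * b i)\<^sup>2)"
          unfolding \<Phi>_def by (intro sum_mono)
        also have "\<dots> = \<Phi> q + (t * (2 * (\<Sum>i\<in>I. r i * b i)) + t\<^sup>2 * (\<Sum>i\<in>I. (b i)\<^sup>2))"
          by (simp add: \<Phi>_def r_def[symmetric] power2_sum power_mult_distrib sum.distrib
              sum_distrib_left algebra_simps)
        finally show "0 \<le> t * (2 * (\<Sum>i\<in>I. r i * b i)) + t\<^sup>2 * (\<Sum>i\<in>I. (b i)\<^sup>2)"
          using min[OF \<open>u \<in> weights J\<close>] by simp
      qed
      then have "(\<Sum>i\<in>I. r i * L q i) \<le> (\<Sum>i\<in>I. r i * A i j)"
        by (simp add: b_def algebra_simps sum_subtractf)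
      \<comment> \<open>Termwise \<open>r i * (L q i - v) = (r i)\<^sup>2\<close>, because
        \<open>r i\<close> vanishes wherever \<open>L q i\<close> is at most \<open>v\<close>. The
        positive sum of squares makes the final inequality strict.\<close>
      moreover have "(\<Sum>i\<in>I. r i * L q i) = (\<Sum>i\<in>I. (r i)\<^sup>2) + v * R"
        unfolding R_def sum_distrib_left sum.distrib[symmetric]
        by (intro sum.cong) (auto simp: r_def max_def power2_eq_square algebra_simps)
      ultimately have "v * R < (\<Sum>i\<in>I. r i * A i j)"
        using sq by linarith
      then show ?thesis
        using \<open>0 < R\<close> by (simp add: pos_less_divide_eq flip: sum_divide_distrib)
    qed
    moreover have "(\<lambda>i. if i \<in> I then r i / R else 0) \<in> weights I"
      using r_nonneg \<open>0 < R\<close>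
      by (auto simp: weights_def R_def simp flip: sum_divide_distrib)
    ultimately show ?thesis
      by (intro disjI2 bexI[of _ "\<lambda>i. if i \<in> I then r i / R else 0"]) auto
  qed
qed

text \<open>By compactness some \<open>p\<close> maximises the guaranteed payoff. At that payoff the
  second alternative of \<open>minimax_alternative\<close> would give a better row strategy, so the
  first one holds and yields \<open>q\<close>.\<close>

lemma minimax_saddle_point:
  fixes A :: "'i \<Rightarrow> 'j \<Rightarrow> real"
  assumes "finite I" "I \<noteq> {}" "finite J" "J \<noteq> {}"
  obtains p q v where "p \<in> weights I" "q \<in> weights J"
    "\<forall>j\<in>J. v \<le> (\<Sum>i\<in>I. p i * A i j)" "\<forall>i\<in>I. (\<Sum>j\<in>J. q j * A i j) \<le> v"
proof -
  define f where "f p = Min ((\<lambda>j. \<Sum>i\<in>I. p i * A i j) ` J)" for p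
  have "continuous_on (weights I) f"
    unfolding f_def using assms
    by (intro continuous_on_Min continuous_intros
        continuous_on_subset[OF continuous_on_product_coordinates]) auto
  moreover have "weights I \<noteq> {}"
    using assms by (intro weights_nonempty)
  ultimately obtain p where p: "p \<in> weights I" and max: "\<And>p'. p' \<in> weights I \<Longrightarrow> f p' \<le> f p"
    using continuous_attains_sup[OF compact_weights[OF \<open>finite I\<close>], of f] by auto
  have "\<not> (\<exists>p' \<in> weights I. \<forall>j\<in>J. f p < (\<Sum>i\<in>I. p' i * A i j))"
  proof
    assume "\<exists>p' \<in> weights I. \<forall>j\<in>J. f p < (\<Sum>i\<in>I. p' i * A i j)"
    then obtain p' where "p' \<in> weights I" "f p < f p'"
      using assms by (auto simp: f_def)
    with max show False
      by (simp add: leD)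
  qed
  then obtain q where "q \<in> weights J" "\<forall>i\<in>I. (\<Sum>j\<in>J. q j * A i j) \<le> f p"
    using minimax_alternative[of I J A "f p"] assms by blast
  with p show ?thesis
    using assms by (intro that[of p q "f p"]) (auto simp: f_def)
qed

section \<open>From weight vectors to probability mass functions, and from infinite to finite
  strategy sets\<close>

lemma weights_pmf:
  assumes "finite J" "w \<in> weights J"
  obtains P where "set_pmf P \<subseteq> J"
    "\<forall>f :: 'a \<Rightarrow> nat. (\<integral>\<^sup>+ j. of_nat (f j) \<partial>measure_pmf P) = ennreal (\<Sum>j\<in>J. w j * real (f j))"
proof -
  have w: "0 \<le> w j" "j \<notin> J \<Longrightarrow> w j = 0" "sum w J = 1" for j
    using assms by (auto simp: weights_def)
  have "(\<integral>\<^sup>+ j. ennreal (w j) \<partial>count_space UNIV) = (\<Sum>j\<in>J. ennreal (w j))"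
    using w assms by (intro nn_integral_count_space'[of J]) auto
  then have 1: "(\<integral>\<^sup>+ j. ennreal (w j) \<partial>count_space UNIV) = 1"
    using w by (simp add: sum_ennreal)
  define P where "P = embed_pmf w"
  have pmf: "pmf P j = w j" for j
    using w 1 by (simp add: P_def pmf_embed_pmf)
  have set: "set_pmf P \<subseteq> J"
    using w(2) by (force simp: set_pmf_iff pmf)
  show ?thesis
  proof (rule that[OF set], rule allI)
    fix f :: "'a \<Rightarrow> nat"
    have "(\<integral>\<^sup>+ j. of_nat (f j) \<partial>measure_pmf P) = (\<Sum>j\<in>J. of_nat (f j) * ennreal (w j))"
      using set assms by (subst nn_integral_measure_pmf_support[of J]) (auto simp: pmf)
    also have "\<dots> = (\<Sum>j\<in>J. ennreal (w j * real (f j)))"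
      using w by (intro sum.cong) (auto simp: ennreal_of_nat_eq_real_of_nat ennreal_mult' mult.commute)
    also have "\<dots> = ennreal (\<Sum>j\<in>J. w j * real (f j))"
      using w by (intro sum_ennreal) auto
    finally show "(\<integral>\<^sup>+ j. of_nat (f j) \<partial>measure_pmf P) = ennreal (\<Sum>j\<in>J. w j * real (f j))" .
  qed
qed

text \<open>On the finite set \<open>S\<close> there are only finitely many cost vectors with
  entries at most \<open>B\<close>; \<open>J\<close> takes one representative of each that
  occurs.\<close>

lemma finite_dominating_subset:
  fixes c :: "'t \<Rightarrow> 's \<Rightarrow> nat"
  assumes "finite S"
    and "\<And>T. T \<in> D \<Longrightarrow> \<exists>T'\<in>D. \<forall>s\<in>S. c T' s \<le> c T s \<and> c T' s \<le> B"
  obtains J where "finite J" "J \<subseteq> D" "\<forall>T\<in>D. \<exists>T'\<in>J. \<forall>s\<in>S. c T' s \<le> c T s"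
proof -
  define E where "E = {T \<in> D. \<forall>s\<in>S. c T s \<le> B}"
  have "(\<lambda>T. restrict (c T) S) ` E \<subseteq> PiE S (\<lambda>_. {..B})"
    by (auto simp: E_def)
  moreover have "finite (PiE S (\<lambda>_. {..B}))"
    using assms by (intro finite_PiE) auto
  ultimately have "finite ((\<lambda>T. restrict (c T) S) ` E)"
    using finite_subset by blast
  then obtain J where J: "J \<subseteq> E" "finite J" "(\<lambda>T. restrict (c T) S) ` E = (\<lambda>T. restrict (c T) S) ` J"
    using finite_subset_image[of "(\<lambda>T. restrict (c T) S) ` E" "\<lambda>T. restrict (c T) S" E] by auto
  show ?thesis
  proof (rule that[OF \<open>finite J\<close>])
    show "J \<subseteq> D"
      using J by (auto simp: E_def)
    show "\<forall>T\<in>D. \<exists>T'\<in>J. \<forall>s\<in>S. c T' s \<le> c T s"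
    proof
      fix T assume "T \<in> D"
      then obtain T' where "T' \<in> E" and le: "\<forall>s\<in>S. c T' s \<le> c T s"
        using assms(2)[of T] by (auto simp: E_def)
      then obtain T'' where "T'' \<in> J" "restrict (c T') S = restrict (c T'') S"
        using J(3) by blast
      then have "\<forall>s\<in>S. c T'' s = c T' s"
        by (metis restrict_apply')
      with le \<open>T'' \<in> J\<close> show "\<exists>T'\<in>J. \<forall>s\<in>S. c T' s \<le> c T s"
        by (intro bexI[of _ T'']) auto
    qed
  qed
qed

text \<open>The integral over \<open>P\<close> is a finite sum, so the exchange is just linearity of
  the integral over \<open>Q\<close>, whose support may be infinite.\<close>

lemma nn_integral_pmf_finite_swap:
  fixes h :: "'s \<Rightarrow> 't \<Rightarrow> ennreal"
  assumes "finite S" "set_pmf P \<subseteq> S"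
  shows "(\<integral>\<^sup>+ s. (\<integral>\<^sup>+ t. h s t \<partial>measure_pmf Q) \<partial>measure_pmf P)
       = (\<integral>\<^sup>+ t. (\<integral>\<^sup>+ s. h s t \<partial>measure_pmf P) \<partial>measure_pmf Q)"
proof -
  have *: "(\<integral>\<^sup>+ s. f s \<partial>measure_pmf P) = (\<Sum>s\<in>S. f s * pmf P s)" for f :: "'s \<Rightarrow> ennreal"
    using assms by (intro nn_integral_measure_pmf_support) auto
  show ?thesis
    by (simp add: * nn_integral_sum nn_integral_multc)
qed

lemma nn_integral_pmf_le:
  fixes f :: "'a \<Rightarrow> ennreal"
  assumes "\<And>x. x \<in> set_pmf P \<Longrightarrow> f x \<le> V"
  shows "(\<integral>\<^sup>+ x. f x \<partial>measure_pmf P) \<le> V"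
proof -
  have "(\<integral>\<^sup>+ x. f x \<partial>measure_pmf P) \<le> (\<integral>\<^sup>+ x. V \<partial>measure_pmf P)"
    using assms by (intro nn_integral_mono_AE) (auto simp: AE_measure_pmf_iff)
  then show ?thesis
    by (simp add: measure_pmf.emeasure_space_1)
qed

lemma nn_integral_pmf_ge:
  fixes f :: "'a \<Rightarrow> ennreal"
  assumes "\<And>x. x \<in> set_pmf P \<Longrightarrow> V \<le> f x"
  shows "V \<le> (\<integral>\<^sup>+ x. f x \<partial>measure_pmf P)"
proof -
  have "(\<integral>\<^sup>+ x. V \<partial>measure_pmf P) \<le> (\<integral>\<^sup>+ x. f x \<partial>measure_pmf P)"
    using assms by (intro nn_integral_mono_AE) (auto simp: AE_measure_pmf_iff)
  then show ?thesis
    by (simp add: measure_pmf.emeasure_space_1)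
qed

lemma has_max_finite: "finite S \<Longrightarrow> S \<noteq> {} \<Longrightarrow> has_max F S"
proof -
  assume "finite S" "S \<noteq> {}"
  then have "Max (F ` S) \<in> F ` S" "\<And>t. t \<in> S \<Longrightarrow> F t \<le> Max (F ` S)"
    by auto
  then show ?thesis
    by (force simp: has_max_def)
qed

text \<open>
  A zero-sum game in which the minimiser picks a strategy from a possibly infinite set \<open>D\<close>.
  The set can be replaced by a finite one because every strategy is dominated by one with
  costs at most \<open>B\<close>, and there are only finitely many such cost vectors.
\<close>

locale bounded_game =
  fixes S :: "'s set" and D :: "'t set" and c :: "'t \<Rightarrow> 's \<Rightarrow> nat" and B :: nat
  assumes finite_S: "finite S" and D_nonempty: "D \<noteq> {}"
    and dominated: "\<And>T. T \<in> D \<Longrightarrow> \<exists>T'\<in>D. \<forall>s\<in>S. c T' s \<le> c T s \<and> c T' s \<le> B"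
begin

definition mixed_cost :: "'t pmf \<Rightarrow> ennreal" where
  "mixed_cost Q = (SUP s\<in>S. \<integral>\<^sup>+ T. of_nat (c T s) \<partial>measure_pmf Q)"

definition dist_cost :: "'s pmf \<Rightarrow> 't \<Rightarrow> ennreal" where
  "dist_cost P T = (\<integral>\<^sup>+ s. of_nat (c T s) \<partial>measure_pmf P)"

lemma dist_cost_mono:
  "set_pmf P \<subseteq> S \<Longrightarrow> \<forall>s\<in>S. c T s \<le> c T' s \<Longrightarrow> dist_cost P T \<le> dist_cost P T'"
  unfolding dist_cost_def
  by (intro nn_integral_mono_AE) (auto simp: AE_measure_pmf_iff)

lemma has_min_dist_cost:
  assumes "set_pmf P \<subseteq> S"
  shows "has_min (dist_cost P) D"
proof -
  obtain J where J: "finite J" "J \<subseteq> D" "\<forall>T\<in>D. \<exists>T'\<in>J. \<forall>s\<in>S. c T' s \<le> c T s"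
    by (rule finite_dominating_subset[where c = c, OF finite_S dominated])
  have "J \<noteq> {}"
    using J(3) D_nonempty by blast
  define T0 where "T0 = arg_min_on (dist_cost P) J"
  have "T0 \<in> J"
    unfolding T0_def using \<open>finite J\<close> \<open>J \<noteq> {}\<close> by (rule arg_min_if_finite)
  have "dist_cost P T0 \<le> dist_cost P T" if "T \<in> D" for T
  proof -
    obtain T' where "T' \<in> J" "\<forall>s\<in>S. c T' s \<le> c T s"
      using J(3) \<open>T \<in> D\<close> by blast
    then show ?thesis
      using arg_min_least[OF \<open>finite J\<close> \<open>J \<noteq> {}\<close>] dist_cost_mono[OF assms]
      unfolding T0_def by (meson order_trans)
  qed
  with \<open>T0 \<in> J\<close> J(2) show ?thesis
    by (auto simp: has_min_def)
qed

text \<open>The saddle point is taken in the finite game on \<open>J\<close>. The guarantee of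
  \<open>P\<close> extends to all of \<open>D\<close> by domination, while \<open>Q\<close> is
  already supported in \<open>D\<close>.\<close>

lemma saddle_point:
  assumes "S \<noteq> {}"
  obtains P Q V where "set_pmf P \<subseteq> S" "set_pmf Q \<subseteq> D"
    "\<forall>T\<in>D. V \<le> dist_cost P T" "mixed_cost Q \<le> V"
proof -
  obtain J where J: "finite J" "J \<subseteq> D" "\<forall>T\<in>D. \<exists>T'\<in>J. \<forall>s\<in>S. c T' s \<le> c T s"
    by (rule finite_dominating_subset[where c = c, OF finite_S dominated])
  have "J \<noteq> {}"
    using J(3) D_nonempty by blast
  obtain p q v where p: "p \<in> weights S" and q: "q \<in> weights J"
    and p_ge: "\<forall>T\<in>J. v \<le> (\<Sum>s\<in>S. p s * real (c T s))"
    and q_le: "\<forall>s\<in>S. (\<Sum>T\<in>J. q T * real (c T s)) \<le> v"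
    by (rule minimax_saddle_point[OF finite_S assms \<open>finite J\<close> \<open>J \<noteq> {}\<close>])
  obtain P where P: "set_pmf P \<subseteq> S"
    "\<forall>f :: 's \<Rightarrow> nat. (\<integral>\<^sup>+ s. of_nat (f s) \<partial>measure_pmf P) = ennreal (\<Sum>s\<in>S. p s * real (f s))"
    by (rule weights_pmf[OF finite_S p])
  obtain Q where Q: "set_pmf Q \<subseteq> J"
    "\<forall>f :: 't \<Rightarrow> nat. (\<integral>\<^sup>+ T. of_nat (f T) \<partial>measure_pmf Q) = ennreal (\<Sum>T\<in>J. q T * real (f T))"
    by (rule weights_pmf[OF \<open>finite J\<close> q])
  show ?thesis
  proof (rule that)
    show "set_pmf P \<subseteq> S" "set_pmf Q \<subseteq> D"
      using P Q J by auto
    show "mixed_cost Q \<le> ennreal v"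
      unfolding mixed_cost_def Q(2)[rule_format] using q_le by (intro SUP_least ennreal_leI) simp
    show "\<forall>T\<in>D. ennreal v \<le> dist_cost P T"
    proof
      fix T assume "T \<in> D"
      then obtain T' where T': "T' \<in> J" "\<forall>s\<in>S. c T' s \<le> c T s"
        using J(3) by blast
      have "ennreal v \<le> dist_cost P T'"
        unfolding dist_cost_def P(2)[rule_format] using p_ge T'(1) by (simp add: ennreal_leI)
      also have "\<dots> \<le> dist_cost P T"
        using P(1) T'(2) by (rule dist_cost_mono)
      finally show "ennreal v \<le> dist_cost P T" .
    qed
  qed
qed

text \<open>Average the guarantee of \<open>P\<close> over \<open>Q\<close>, exchange the integrals,
  and bound the average over \<open>P\<close> by the supremum over \<open>S\<close>.\<close>

lemma weak_duality:
  assumes "set_pmf P \<subseteq> S" "set_pmf Q \<subseteq> D" "\<forall>T\<in>D. V \<le> dist_cost P T"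
  shows "V \<le> mixed_cost Q"
proof -
  have "V \<le> (\<integral>\<^sup>+ T. dist_cost P T \<partial>measure_pmf Q)"
    using assms by (intro nn_integral_pmf_ge) auto
  also have "\<dots> = (\<integral>\<^sup>+ s. (\<integral>\<^sup>+ T. of_nat (c T s) \<partial>measure_pmf Q) \<partial>measure_pmf P)"
    unfolding dist_cost_def by (rule nn_integral_pmf_finite_swap[OF finite_S assms(1), symmetric])
  also have "\<dots> \<le> mixed_cost Q"
    unfolding mixed_cost_def using assms by (intro nn_integral_pmf_le SUP_upper) auto
  finally show ?thesis .
qed

text \<open>Weak duality bounds every mixed cost below and every row guarantee above by the saddle
  value, and the saddle strategies attain both bounds.\<close>

lemma game_value:
  assumes "S \<noteq> {}"
  shows minimax_eq_nonempty: "(INF Q\<in>{Q. set_pmf Q \<subseteq> D}. mixed_cost Q)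
           = (SUP P\<in>{P. set_pmf P \<subseteq> S}. INF T\<in>D. dist_cost P T)"
    and has_min_mixed_cost_nonempty: "has_min mixed_cost {Q. set_pmf Q \<subseteq> D}"
    and has_max_dist_cost: "has_max (\<lambda>P. INF T\<in>D. dist_cost P T) {P. set_pmf P \<subseteq> S}"
proof -
  obtain P Q V where *: "set_pmf P \<subseteq> S" "set_pmf Q \<subseteq> D"
    "\<forall>T\<in>D. V \<le> dist_cost P T" "mixed_cost Q \<le> V"
    by (rule saddle_point[OF assms])
  have ge: "V \<le> mixed_cost Q'" if "set_pmf Q' \<subseteq> D" for Q'
    using weak_duality[OF *(1) that *(3)] .
  \<comment> \<open>Weak duality is used here with the value guaranteed by \<open>P'\<close> itself,
    against the saddle strategy \<open>Q\<close>.\<close>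
  have le: "(INF T\<in>D. dist_cost P' T) \<le> V" if "set_pmf P' \<subseteq> S" for P'
    using weak_duality[OF that *(2), of "INF T\<in>D. dist_cost P' T"] *(4)
    by (auto intro: INF_lower order_trans)
  have P: "V \<le> (INF T\<in>D. dist_cost P T)"
    using *(3) by (intro INF_greatest) simp
  show "has_min mixed_cost {Q. set_pmf Q \<subseteq> D}"
    unfolding has_min_def using *(2) order_trans[OF *(4) ge] by (intro bexI[of _ Q]) auto
  show "has_max (\<lambda>P. INF T\<in>D. dist_cost P T) {P. set_pmf P \<subseteq> S}"
    unfolding has_max_def using *(1) order_trans[OF le P] by (intro bexI[of _ P]) auto
  show "(INF Q\<in>{Q. set_pmf Q \<subseteq> D}. mixed_cost Q)
      = (SUP P\<in>{P. set_pmf P \<subseteq> S}. INF T\<in>D. dist_cost P T)"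
  proof (rule order_antisym)
    have "(INF Q\<in>{Q. set_pmf Q \<subseteq> D}. mixed_cost Q) \<le> V"
      using *(2,4) by (intro INF_lower2[of Q]) auto
    also have "V \<le> (SUP P\<in>{P. set_pmf P \<subseteq> S}. INF T\<in>D. dist_cost P T)"
      using *(1) P by (intro SUP_upper2[of P]) auto
    finally show "(INF Q\<in>{Q. set_pmf Q \<subseteq> D}. mixed_cost Q)
        \<le> (SUP P\<in>{P. set_pmf P \<subseteq> S}. INF T\<in>D. dist_cost P T)" .
    have "(SUP P\<in>{P. set_pmf P \<subseteq> S}. INF T\<in>D. dist_cost P T) \<le> V"
      using le by (intro SUP_least) auto
    also have "V \<le> (INF Q\<in>{Q. set_pmf Q \<subseteq> D}. mixed_cost Q)"
      using ge by (intro INF_greatest) auto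
    finally show "(SUP P\<in>{P. set_pmf P \<subseteq> S}. INF T\<in>D. dist_cost P T)
        \<le> (INF Q\<in>{Q. set_pmf Q \<subseteq> D}. mixed_cost Q)" .
  qed
qed

lemma mixed_cost_empty: "S = {} \<Longrightarrow> mixed_cost Q = 0"
  unfolding mixed_cost_def by (simp add: bot_ennreal)

lemma mixed_nonempty: "{Q. set_pmf Q \<subseteq> D} \<noteq> {}"
proof -
  obtain T where "T \<in> D"
    using D_nonempty by blast
  then have "return_pmf T \<in> {Q. set_pmf Q \<subseteq> D}"
    by simp
  then show ?thesis
    by blast
qed

lemma has_min_mixed_cost: "has_min mixed_cost {Q. set_pmf Q \<subseteq> D}"
proof (cases "S = {}")
  case True
  then show ?thesis
    using mixed_nonempty mixed_cost_empty by (auto simp: has_min_def)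
qed (rule has_min_mixed_cost_nonempty)

lemma minimax_eq:
  "(INF Q\<in>{Q. set_pmf Q \<subseteq> D}. mixed_cost Q)
     = (SUP P\<in>{P. set_pmf P \<subseteq> S}. INF T\<in>D. dist_cost P T)"
proof (cases "S = {}")
  case True
  \<comment> \<open>A \<open>pmf\<close> has nonempty support, so the supremum ranges over the empty
    set and is 0.\<close>
  then have "{P. set_pmf P \<subseteq> S} = {}"
    by (simp add: set_pmf_not_empty)
  then show ?thesis
    using mixed_nonempty mixed_cost_empty[OF True] by (simp add: bot_ennreal)
qed (rule minimax_eq_nonempty)

end

section \<open>Decision trees without repeated queries\<close>

text \<open>The map \<open>\<rho>\<close> remembers the answers received on the way from the root; a
  repeated query is answered from it.\<close>

primrec trim :: "('a, 'o) dtree \<Rightarrow> (nat \<rightharpoonup> 'a) \<Rightarrow> ('a, 'o) dtree" where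
  "trim (Answer c) \<rho> = Answer c"
| "trim (Query i k) \<rho> = (case \<rho> i of Some a \<Rightarrow> trim (k a) \<rho>
                          | None \<Rightarrow> Query i (\<lambda>a. trim (k a) (\<rho>(i \<mapsto> a))))"

definition consistent :: "(nat \<rightharpoonup> 'a) \<Rightarrow> 'a list \<Rightarrow> bool" where
  "consistent \<rho> x \<longleftrightarrow> (\<forall>i a. \<rho> i = Some a \<longrightarrow> x ! i = a)"

lemma consistent_empty: "consistent Map.empty x"
  and consistent_upd: "consistent \<rho> x \<Longrightarrow> consistent (\<rho>(i \<mapsto> x ! i)) x"
  and consistentD: "consistent \<rho> x \<Longrightarrow> \<rho> i = Some a \<Longrightarrow> x ! i = a"
  by (auto simp: consistent_def)

lemma wf_trim: "wf_dtree m T \<Longrightarrow> wf_dtree m (trim T \<rho>)"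
  by (induction T arbitrary: \<rho>) (auto split: option.split)

lemma tree_output_trim: "consistent \<rho> x \<Longrightarrow> tree_output (trim T \<rho>) x = tree_output T x"
proof (induction T arbitrary: \<rho>)
  case (Query i k)
  then show ?case
    using Query.IH[OF rangeI[of k "x ! i"] consistent_upd[OF Query.prems, of i]]
    by (cases "\<rho> i") (simp_all add: consistentD fun_upd_def)
qed simp

lemma queries_trim_le: "consistent \<rho> x \<Longrightarrow> queries (trim T \<rho>) x \<le> queries T x"
proof (induction T arbitrary: \<rho>)
  case (Query i k)
  then show ?case
    using Query.IH[OF rangeI[of k "x ! i"] consistent_upd[OF Query.prems, of i]]
    by (cases "\<rho> i") (simp_all add: consistentD le_SucI fun_upd_def)
qed simp

lemma sep_trim_le:
  "consistent \<rho> x \<Longrightarrow> consistent \<rho> y \<Longrightarrow> sep (trim T \<rho>) x y \<le> sep T x y"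
proof (induction T arbitrary: \<rho>)
  case (Query i k)
  show ?case
  proof (cases "\<rho> i")
    case None
    then show ?thesis
      using Query.IH[OF rangeI] consistent_upd[OF Query.prems(1), of i]
        consistent_upd[OF Query.prems(2), of i]
      by auto
  next
    \<comment> \<open>A remembered coordinate has the same value in both strings, so dropping its
      query never drops the separating one.\<close>
    case (Some a)
    then show ?thesis
      using Query.IH[OF rangeI] Query.prems by (auto simp: consistentD le_SucI)
  qed
qed simp

text \<open>Every query that survives trimming adds a new coordinate to \<open>dom \<rho>\<close>,
  which has at most \<open>m\<close> elements.\<close>

lemma queries_trim_bound:
  "wf_dtree m T \<Longrightarrow> dom \<rho> \<subseteq> {..<m} \<Longrightarrow> queries (trim T \<rho>) x + card (dom \<rho>) \<le> m"
proof (induction T arbitrary: \<rho>)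
  case (Answer c)
  then show ?case
    using card_mono[of "{..<m}" "dom \<rho>"] by simp
next
  case (Query i k)
  show ?case
  proof (cases "\<rho> i")
    case None
    have "dom (\<rho>(i \<mapsto> x ! i)) \<subseteq> {..<m}"
      using Query.prems by auto
    then have "queries (trim (k (x ! i)) (\<rho>(i \<mapsto> x ! i))) x + card (dom (\<rho>(i \<mapsto> x ! i))) \<le> m"
      using Query.prems Query.IH[OF rangeI] by (simp del: dom_fun_upd)
    moreover have "finite (dom \<rho>)"
      using Query.prems finite_subset by blast
    ultimately show ?thesis
      using None by (simp add: domIff)
  next
    case (Some a)
    then show ?thesis
      using Query.IH[OF rangeI] Query.prems by auto
  qed
qed

lemma sep_le_queries: "sep T x y \<le> queries T x"
  by (induction T) auto

lemma sep_commute: "sep T x y = sep T y x"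
  by (induction T) auto

lemma trim_in_det_algs: "T \<in> det_algs m f \<Longrightarrow> trim T Map.empty \<in> det_algs m f"
  by (simp add: det_algs_def computes_def wf_trim tree_output_trim consistent_empty)

lemma queries_trim_empty_le:
  assumes "T \<in> det_algs m f"
  shows "queries (trim T Map.empty) x \<le> m"
  using assms queries_trim_bound[of m T Map.empty x] by (simp add: det_algs_def)

section \<open>Existence of algorithms, and boundedness of the two games\<close>

text \<open>Reads the first \<open>n\<close> coordinates from last to first, so each later answer
  goes in front of those already read, and \<open>h\<close> receives the prefix in its right
  order.\<close>

primrec full_tree :: "nat \<Rightarrow> ('a list \<Rightarrow> 'o) \<Rightarrow> ('a, 'o) dtree" where
  "full_tree 0 h = Answer (h [])"
| "full_tree (Suc n) h = Query n (\<lambda>a. full_tree n (\<lambda>x. h (x @ [a])))"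

lemma wf_full_tree: "n \<le> m \<Longrightarrow> wf_dtree m (full_tree n h)"
  by (induction n arbitrary: h) auto

lemma tree_output_full_tree: "n \<le> length x \<Longrightarrow> tree_output (full_tree n h) x = h (take n x)"
  by (induction n arbitrary: h) (auto simp: take_Suc_conv_app_nth)

lemma det_algs_nonempty:
  assumes "dom f \<subseteq> {x. length x = m}"
  shows "det_algs m f \<noteq> {}"
proof -
  have "full_tree m (\<lambda>x. the (f x)) \<in> det_algs m f"
    using assms by (auto simp: det_algs_def computes_def wf_full_tree tree_output_full_tree)
  then show ?thesis
    by blast
qed

text \<open>Trimming provides the dominating strategy: it lowers the cost on all inputs at once and
  bounds it by \<open>m\<close>.\<close>

lemma bounded_game_queries:
  assumes "dom f \<subseteq> {x. length x = m}" "finite (dom f)"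
  shows "bounded_game (dom f) (det_algs m f) queries m"
proof
  show "det_algs m f \<noteq> {}"
    using det_algs_nonempty assms(1) .
  fix T assume T: "T \<in> det_algs m f"
  show "\<exists>T'\<in>det_algs m f. \<forall>x\<in>dom f. queries T' x \<le> queries T x \<and> queries T' x \<le> m"
    using trim_in_det_algs[OF T] queries_trim_le[OF consistent_empty] queries_trim_empty_le[OF T]
    by (intro bexI[of _ "trim T Map.empty"]) auto
qed (fact assms)

lemma bounded_game_sep:
  assumes "dom f \<subseteq> {x. length x = m}" "finite S"
  shows "bounded_game S (det_algs m f) (\<lambda>T (x, y). sep T x y) m"
proof
  show "det_algs m f \<noteq> {}"
    using det_algs_nonempty assms(1) .
  fix T assume T: "T \<in> det_algs m f"
  show "\<exists>T'\<in>det_algs m f. \<forall>s\<in>S. (case s of (x, y) \<Rightarrow> sep T' x y) \<le> (case s of (x, y) \<Rightarrow> sep T x y)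
      \<and> (case s of (x, y) \<Rightarrow> sep T' x y) \<le> m"
    using trim_in_det_algs[OF T] sep_trim_le[OF consistent_empty consistent_empty]
      order_trans[OF sep_le_queries queries_trim_empty_le[OF T]]
    by (intro bexI[of _ "trim T Map.empty"]) auto
qed (fact assms)

section \<open>Sabotage complexity and separation\<close>

text \<open>Stops at the first mark. The leaf value \<open>Star\<close> is arbitrary: on a sabotaged
  input built from strings with different outputs a mark is met before any leaf.\<close>

primrec sab_tree :: "(bool, 'o) dtree \<Rightarrow> (symbol, mark) dtree" where
  "sab_tree (Answer c) = Answer Star"
| "sab_tree (Query i k) = Query i (\<lambda>a. case a of Bit b \<Rightarrow> sab_tree (k b) | Mark s \<Rightarrow> Answer s)"

lemma wf_sab_tree: "wf_dtree m T \<Longrightarrow> wf_dtree m (sab_tree T)"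
  by (induction T) (auto split: symbol.split)

text \<open>An unmarked bit is shared by both strings, so all three inputs follow one path until a
  mark appears. The cost can be below \<open>sep T x y\<close>, since \<open>z\<close> may also hide
  coordinates on which the strings agree.\<close>

lemma sab_tree_correct:
  assumes "\<forall>i<m. z ! i \<noteq> Mark s \<longrightarrow> z ! i = Bit (x ! i) \<and> z ! i = Bit (y ! i)"
    and "wf_dtree m T" "tree_output T x \<noteq> tree_output T y"
  shows "tree_output (sab_tree T) z = s \<and> queries (sab_tree T) z \<le> sep T x y"
  using assms(2,3)
proof (induction T)
  case (Query i k)
  show ?case
  proof (cases "z ! i = Mark s")
    case False
    then have "z ! i = Bit (x ! i)" "x ! i = y ! i"
      using assms(1) Query.prems by auto
    then show ?thesis
      using Query.IH[of "k (x ! i)"] Query.prems by simp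
  qed simp
qed simp

text \<open>The answers of the sabotage tree say nothing about \<open>g\<close>, so each leaf is
  replaced by \<open>F\<close>, which supplies the output.\<close>

primrec unsab_tree :: "(bool, 'o) dtree \<Rightarrow> (symbol, 'q) dtree \<Rightarrow> (bool, 'o) dtree" where
  "unsab_tree F (Answer c) = F"
| "unsab_tree F (Query i k) = Query i (\<lambda>b. unsab_tree F (k (Bit b)))"

lemma wf_unsab_tree: "wf_dtree m F \<Longrightarrow> wf_dtree m U \<Longrightarrow> wf_dtree m (unsab_tree F U)"
  by (induction U) auto

lemma tree_output_unsab_tree: "tree_output (unsab_tree F U) x = tree_output F x"
  by (induction U) auto

text \<open>Different outputs on \<open>z\<close> and \<open>z'\<close> force a query where these
  differ, hence where \<open>x\<close> and \<open>y\<close> differ. So separation happens before a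
  copy of \<open>F\<close> is entered.\<close>

lemma sep_unsab_tree_le:
  assumes "\<forall>i<m. x ! i = y ! i \<longrightarrow> z ! i = Bit (x ! i) \<and> z' ! i = Bit (x ! i)"
    and "wf_dtree m U" "tree_output U z \<noteq> tree_output U z'"
  shows "sep (unsab_tree F U) x y \<le> queries U z"
  using assms(2,3)
proof (induction U)
  case (Query i k)
  show ?case
  proof (cases "x ! i = y ! i")
    case True
    then have "z ! i = Bit (x ! i)" "z' ! i = Bit (x ! i)"
      using assms(1) Query.prems by auto
    then show ?thesis
      using Query.IH[of "k (Bit (x ! i))"] Query.prems True by simp
  qed simp
qed simp

section \<open>Sabotaged inputs and the comparison of the two costs\<close>

definition sabotage :: "nat \<Rightarrow> mark \<Rightarrow> bool list \<Rightarrow> bool list \<Rightarrow> symbol list" where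
  "sabotage m s x y = map (\<lambda>i. if x ! i = y ! i then Bit (x ! i) else Mark s) [0..<m]"

lemma sabotage_in_sab_inputs:
  "x \<in> ginv g False \<Longrightarrow> y \<in> ginv g True \<Longrightarrow> sabotage m s x y \<in> sab_inputs m g s"
  unfolding sab_inputs_def mem_Collect_eq
  by (intro conjI bexI[of _ x] bexI[of _ y]) (auto simp: sabotage_def)

lemma pfun_eq_Some_iff: "pfun g x = Some b \<longleftrightarrow> x \<in> ginv g b"
  by (cases b) (auto simp: pfun_def ginv_def)

lemma dom_pfun: "dom (pfun g) = ginv g False \<union> ginv g True"
  by (auto simp: pfun_def ginv_def split: if_splits)

lemma sep_pairs_eq:
  "sep_pairs g = ginv g False \<times> ginv g True \<union> ginv g True \<times> ginv g False"
  by (auto simp: sep_pairs_def dom_pfun pfun_def ginv_def split: if_splits)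

lemma g_sab_SomeD: "g_sab m g z = Some s \<Longrightarrow> z \<in> sab_inputs m g s"
  by (auto simp: g_sab_def split: if_splits)

lemma dom_g_sab: "dom (g_sab m g) = sab_inputs m g Star \<union> sab_inputs m g Dagger"
  by (auto simp: g_sab_def split: if_splits)

lemma dom_g_sab_length: "dom (g_sab m g) \<subseteq> {z. length z = m}"
  by (auto simp: dom_g_sab sab_inputs_def)

lemma finite_dom_g_sab: "finite (dom (g_sab m g))"
proof (rule finite_subset)
  let ?A = "range Bit \<union> {Mark Star, Mark Dagger}"
  show "dom (g_sab m g) \<subseteq> {z. set z \<subseteq> ?A \<and> length z = m}"
    by (auto simp: dom_g_sab sab_inputs_def)
  show "finite {z. set z \<subseteq> ?A \<and> length z = m}"
    by (intro finite_lists_length_eq) simp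
qed

text \<open>As \<open>sep\<close> is symmetric, the order of a pair is immaterial; this identifies
  \<open>worst_sep\<close> with the mixed cost of the game on pairs.\<close>

lemma worst_sep_eq:
  "worst_sep g Q = (SUP s\<in>ginv g False \<times> ginv g True.
     \<integral>\<^sup>+ T. of_nat (case s of (x, y) \<Rightarrow> sep T x y) \<partial>measure_pmf Q)"
  (is "_ = (SUP s\<in>?S. ?E s)")
proof (rule order_antisym)
  show "worst_sep g Q \<le> (SUP s\<in>?S. ?E s)"
    unfolding worst_sep_def
  proof (rule SUP_least)
    fix s assume "s \<in> sep_pairs g"
    then obtain x y where xy: "(x, y) \<in> ?S" "s = (x, y) \<or> s = (y, x)"
      by (auto simp: sep_pairs_eq)
    then have "exp_sep_alg Q s = ?E (x, y)"
      by (auto simp: exp_sep_alg_def sep_commute[of _ y x])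
    with xy(1) show "exp_sep_alg Q s \<le> (SUP s\<in>?S. ?E s)"
      by (intro SUP_upper2[of "(x, y)"]) auto
  qed
  show "(SUP s\<in>?S. ?E s) \<le> worst_sep g Q"
    unfolding worst_sep_def
    by (rule SUP_subset_mono) (auto simp: exp_sep_alg_def sep_pairs_eq)
qed

lemma sep_le_worst_sep:
  assumes "x \<in> ginv g False" "y \<in> ginv g True"
  shows "(\<integral>\<^sup>+ T. of_nat (sep T x y) \<partial>measure_pmf Q) \<le> worst_sep g Q"
  unfolding worst_sep_eq using assms by (intro SUP_upper2[of "(x, y)"]) auto

lemma RS_le_worst_sep:
  assumes "\<T> \<in> zero_error_algs m (pfun g)"
  shows "RS m g \<le> worst_sep g \<T>"
proof -
  have T: "wf_dtree m T" "x \<in> ginv g b \<Longrightarrow> tree_output T x = b" if "T \<in> set_pmf \<T>" for T x b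
    using assms that
    by (auto simp: zero_error_algs_def det_algs_def computes_def pfun_eq_Some_iff subset_iff)
  \<comment> \<open>The pair depends on \<open>z\<close> only and serves all trees in the support
    simultaneously, which is what allows expectations to be compared.\<close>
  have sab: "\<exists>x\<in>ginv g False. \<exists>y\<in>ginv g True. \<forall>T\<in>set_pmf \<T>.
      tree_output (sab_tree T) z = s \<and> queries (sab_tree T) z \<le> sep T x y"
    if "g_sab m g z = Some s" for z s
  proof -
    obtain x y where xy: "x \<in> ginv g False" "y \<in> ginv g True"
      and z: "\<forall>i<m. z ! i \<noteq> Mark s \<longrightarrow> z ! i = Bit (x ! i) \<and> z ! i = Bit (y ! i)"
      using g_sab_SomeD[OF \<open>g_sab m g z = Some s\<close>] by (auto simp: sab_inputs_def)
    then show ?thesis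
      using sab_tree_correct[OF z] T by (metis (full_types))
  qed
  have "map_pmf sab_tree \<T> \<in> zero_error_algs m (g_sab m g)"
    using T(1) sab by (force simp: zero_error_algs_def det_algs_def computes_def wf_sab_tree)
  moreover have "worst_queries (g_sab m g) (map_pmf sab_tree \<T>) \<le> worst_sep g \<T>"
    unfolding worst_queries_def
  proof (rule SUP_least)
    fix z assume "z \<in> dom (g_sab m g)"
    then obtain x y where xy: "x \<in> ginv g False" "y \<in> ginv g True"
      and le: "\<forall>T\<in>set_pmf \<T>. queries (sab_tree T) z \<le> sep T x y"
      using sab by blast
    have "(\<integral>\<^sup>+ T. of_nat (queries T z) \<partial>measure_pmf (map_pmf sab_tree \<T>))
        = (\<integral>\<^sup>+ T. of_nat (queries (sab_tree T) z) \<partial>measure_pmf \<T>)"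
      by simp
    also have "\<dots> \<le> (\<integral>\<^sup>+ T. of_nat (sep T x y) \<partial>measure_pmf \<T>)"
      using le by (intro nn_integral_mono_AE) (auto simp: AE_measure_pmf_iff)
    also have "\<dots> \<le> worst_sep g \<T>"
      using xy by (rule sep_le_worst_sep)
    finally show "(\<integral>\<^sup>+ T. of_nat (queries T z) \<partial>measure_pmf (map_pmf sab_tree \<T>))
        \<le> worst_sep g \<T>" .
  qed
  ultimately show ?thesis
    unfolding RS_def R0_def by (rule INF_lower2)
qed

lemma worst_sep_le_worst_queries:
  assumes g: "dom (pfun g) \<subseteq> {x. length x = m}"
    and U: "\<U> \<in> zero_error_algs m (g_sab m g)"
  obtains \<T> where "\<T> \<in> zero_error_algs m (pfun g)"
    "worst_sep g \<T> \<le> worst_queries (g_sab m g) \<U>"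
proof -
  obtain F where F: "F \<in> det_algs m (pfun g)"
    using det_algs_nonempty[OF g] by blast
  define \<T> where "\<T> = map_pmf (unsab_tree F) \<U>"
  have U': "wf_dtree m T" "g_sab m g z = Some s \<Longrightarrow> tree_output T z = s"
    if "T \<in> set_pmf \<U>" for T z s
    using U that by (auto simp: zero_error_algs_def det_algs_def computes_def subset_iff)
  show ?thesis
  proof (rule that)
    show "\<T> \<in> zero_error_algs m (pfun g)"
      using F U'(1) by (auto simp: \<T>_def zero_error_algs_def det_algs_def computes_def
          wf_unsab_tree tree_output_unsab_tree)
    show "worst_sep g \<T> \<le> worst_queries (g_sab m g) \<U>"
      unfolding worst_sep_eq
    proof (rule SUP_least, safe)
      fix x y assume xy: "x \<in> ginv g False" "y \<in> ginv g True"
      define z where "z s = sabotage m s x y" for s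
      have Star: "g_sab m g (z Star) = Some Star"
        using sabotage_in_sab_inputs[OF xy, of m Star] by (simp add: g_sab_def z_def)
      \<comment> \<open>Since \<open>g_sab\<close> tests \<open>Star\<close> first, a string gets
        the value \<open>Dagger\<close> only if it is no \<open>Star\<close> input; a visible dagger
        ensures this.\<close>
      have "x \<noteq> y" "length x = m" "length y = m"
        using xy g by (auto simp: ginv_def dom_pfun)
      then obtain i where "i < m" "x ! i \<noteq> y ! i"
        using nth_equalityI[of x y] by auto
      then have "Mark Dagger \<in> set (z Dagger)"
        by (force simp: z_def sabotage_def)
      then have "z Dagger \<notin> sab_inputs m g Star"
        by (auto simp: sab_inputs_def)
      then have Dagger: "g_sab m g (z Dagger) = Some Dagger"
        using sabotage_in_sab_inputs[OF xy, of m Dagger] by (simp add: g_sab_def z_def)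
      have agree: "\<forall>i<m. x ! i = y ! i \<longrightarrow> z Star ! i = Bit (x ! i) \<and> z Dagger ! i = Bit (x ! i)"
        by (simp add: z_def sabotage_def)
      have le: "sep (unsab_tree F T) x y \<le> queries T (z Star)" if "T \<in> set_pmf \<U>" for T
        using sep_unsab_tree_le[OF agree U'(1)[OF that]] U'(2)[OF that Star] U'(2)[OF that Dagger]
        by simp
      have "(\<integral>\<^sup>+ T. of_nat (sep T x y) \<partial>measure_pmf \<T>)
          = (\<integral>\<^sup>+ T. of_nat (sep (unsab_tree F T) x y) \<partial>measure_pmf \<U>)"
        by (simp add: \<T>_def)
      also have "\<dots> \<le> (\<integral>\<^sup>+ T. of_nat (queries T (z Star)) \<partial>measure_pmf \<U>)"
        using le by (intro nn_integral_mono_AE) (auto simp: AE_measure_pmf_iff)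
      also have "\<dots> \<le> worst_queries (g_sab m g) \<U>"
        unfolding worst_queries_def using Star by (intro SUP_upper) auto
      finally show "(\<integral>\<^sup>+ T. of_nat (sep T x y) \<partial>measure_pmf \<T>)
          \<le> worst_queries (g_sab m g) \<U>" .
    qed
  qed
qed

lemma RS_eq_INF_worst_sep:
  assumes "dom (pfun g) \<subseteq> {x. length x = m}"
  shows "RS m g = (INF \<T> \<in> zero_error_algs m (pfun g). worst_sep g \<T>)"
proof (rule order_antisym)
  show "RS m g \<le> (INF \<T> \<in> zero_error_algs m (pfun g). worst_sep g \<T>)"
    by (intro INF_greatest RS_le_worst_sep)
  show "(INF \<T> \<in> zero_error_algs m (pfun g). worst_sep g \<T>) \<le> RS m g"
    unfolding RS_def R0_def
  proof (rule INF_greatest)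
    fix \<U> assume "\<U> \<in> zero_error_algs m (g_sab m g)"
    then obtain \<T> where "\<T> \<in> zero_error_algs m (pfun g)"
      "worst_sep g \<T> \<le> worst_queries (g_sab m g) \<U>"
      by (rule worst_sep_le_worst_queries[OF assms])
    then show "(INF \<T> \<in> zero_error_algs m (pfun g). worst_sep g \<T>) \<le> worst_queries (g_sab m g) \<U>"
      by (rule INF_lower2)
  qed
qed

text \<open>The maxima are claimed only when both preimages are nonempty: otherwise there is no pair
  and no distribution at which they could be attained, and the suprema are 0.\<close>

theorem theorem11:
  fixes m :: nat and g :: "(bool list \<times> bool) set"
  assumes "g \<subseteq> {x. length x = m} \<times> UNIV"
  shows "RS m g = (INF \<T> \<in> zero_error_algs m (pfun g). worst_sep g \<T>)
       \<and> (INF \<T> \<in> zero_error_algs m (pfun g). worst_sep g \<T>)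
           = (SUP p \<in> pair_dists g. best_sep m g p)
       \<and> has_min (worst_queries (g_sab m g)) (zero_error_algs m (g_sab m g))
       \<and> has_min (worst_sep g) (zero_error_algs m (pfun g))
       \<and> (\<forall>p \<in> pair_dists g. has_min (exp_sep_dist p) (det_algs m (pfun g)))
       \<and> (ginv g False \<noteq> {} \<and> ginv g True \<noteq> {} \<longrightarrow>
            (\<forall>\<T> \<in> zero_error_algs m (pfun g). has_max (exp_sep_alg \<T>) (sep_pairs g))
          \<and> has_max (best_sep m g) (pair_dists g))"
proof -
  have dom: "dom (pfun g) \<subseteq> {x. length x = m}"
    using assms by (auto simp: dom_pfun ginv_def)
  have "finite {x :: bool list. length x = m}"
    using finite_lists_length_eq[of "UNIV :: bool set" m] by simp
  then have fin: "finite (ginv g b)" for b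
    using dom by (cases b) (auto simp: dom_pfun intro: finite_subset)
  let ?S = "ginv g False \<times> ginv g True"
  \<comment> \<open>The game on sabotaged inputs gives attainment of the minimum defining
    \<open>RS\<close>; the game on pairs gives the minimax equality and the other optima over
    algorithms and distributions.\<close>
  interpret sab: bounded_game "dom (g_sab m g)" "det_algs m (g_sab m g)" queries m
    by (rule bounded_game_queries[OF dom_g_sab_length finite_dom_g_sab])
  interpret sp: bounded_game ?S "det_algs m (pfun g)" "\<lambda>T (x, y). sep T x y" m
    using dom fin by (intro bounded_game_sep) auto
  have wq: "worst_queries (g_sab m g) = sab.mixed_cost"
    by (simp add: fun_eq_iff worst_queries_def sab.mixed_cost_def)
  have ws: "worst_sep g = sp.mixed_cost"
    by (simp add: fun_eq_iff worst_sep_eq sp.mixed_cost_def)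
  have esd: "exp_sep_dist = sp.dist_cost"
    unfolding fun_eq_iff exp_sep_dist_def sp.dist_cost_def by (simp add: case_prod_unfold)
  have bs: "best_sep m g = (\<lambda>P. INF T\<in>det_algs m (pfun g). sp.dist_cost P T)"
    by (simp add: fun_eq_iff best_sep_def esd)
  have "finite (sep_pairs g)"
    using fin by (simp add: sep_pairs_eq)
  then have "has_max (exp_sep_alg \<T>) (sep_pairs g)" if "?S \<noteq> {}" for \<T>
    using that by (intro has_max_finite) (auto simp: sep_pairs_eq)
  then show ?thesis
    using RS_eq_INF_worst_sep[OF dom] sab.has_min_mixed_cost sp.has_min_mixed_cost sp.minimax_eq
      sp.has_min_dist_cost sp.has_max_dist_cost
    by (simp add: wq ws esd bs zero_error_algs_def pair_dists_def)
qed

end
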